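(* Let $G \in ER(n,d,\lambda)$, let $m \ge 2$, and let $X = \{x_1,\dots,x_p\}$ with integers $1 \le x_1 < \dots < x_p$. Then $D_m^X(G)$ is edge-regular if and only if there exist integers $\bar d, \bar\lambda$ such that: (1) for all $v \in V(G)$, $\sum_{i=1}^{p} |N^{x_i}(v)| = \bar d$; (2) for all $u,v \in V(G)$ with $u \sim v$ in $G$, $\sum_{i=1}^{p}\sum_{j=1}^{p} |N^{x_i}(u) \cap N^{x_j}(v)| = \bar\lambda$; (3) for all $v,w \in V(G)$ with $w \in \bigcup_{q=1}^{p} N^{x_q}(v)$, $\sum_{i=1}^{p} |N(v) \cap N^{x_i}(w)| + \sum_{j=1}^{p} |N^{x_j}(v) \cap N(w)| + (m-2)\sum_{k=1}^{p}\sum_{l=1}^{p} |N^{x_k}(v) \cap N^{x_l}(w)| = \lambda + (m-1)\bar\lambda$.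
   Context: All graphs are finite and simple. For a vertex $v$ of $G$, $N(v)$ is its neighborhood and, for a positive integer $x$, $N^x(v)$ is the set of vertices at distance exactly $x$ from $v$ in $G$. A graph is edge-regular if it is regular and there is $\lambda \ge 0$ such that every two adjacent vertices have exactly $\lambda$ common neighbors; $ER(n,d,\lambda)$ denotes the set of edge-regular graphs on $n$ vertices, regular of degree $d$, with parameter $\lambda$. For $m \ge 2$ and $X = \{x_1,\dots,x_p\}$ with $1\le x_1<\dots<x_p$, the $(m,X)$-shadow $D_m^X(G)$ is the simple graph whose vertex set is the disjoint union of $m$ copies $G_1,\dots,G_m$ of $G$ (the copy of $u\in V(G)$ in $G_i$ denoted $u_i$), with edges $u_iv_i$ for $1 \le i \le m$ and $uv \in E(G)$, and edges $u_iv_j$ for $i \neq j$ whenever $u \in \bigcup_{k=1}^{p} N^{x_k}(v)$. *)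

theory Defs
  imports "Graph_Theory.Graph_Theory"
begin

text \<open>A finite simple graph is a \<^locale>\<open>pair_graph\<close>: finite, loop-free and symmetric, each edge being
  represented by its two arcs.\<close>

definition nbhd :: "'a pair_pre_digraph \<Rightarrow> 'a \<Rightarrow> 'a set" where
  "nbhd G v = {u \<in> pverts G. (v, u) \<in> parcs G}"

text \<open>The distance is the cost of a shortest walk for unit arc costs; it is infinite between
  different components, so vertices of other components lie in no \<open>nbhd_at G x v\<close>.\<close>

definition gdist :: "'a pair_pre_digraph \<Rightarrow> 'a \<Rightarrow> 'a \<Rightarrow> ereal" where
  "gdist G = wf_digraph.\<mu> (with_proj G) (\<lambda>_. 1)"

definition nbhd_at :: "'a pair_pre_digraph \<Rightarrow> nat \<Rightarrow> 'a \<Rightarrow> 'a set" where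
  "nbhd_at G x v = {u \<in> pverts G. gdist G v u = ereal (real x)}"

text \<open>The degree in a symmetric loop-free digraph is the out-degree.\<close>

definition ER :: "nat \<Rightarrow> nat \<Rightarrow> nat \<Rightarrow> 'a pair_pre_digraph set" where
  "ER n d l = {G. pair_graph G \<and> card (pverts G) = n \<and>
     (\<forall>v \<in> pverts G. out_degree (with_proj G) v = d) \<and>
     (\<forall>u \<in> pverts G. \<forall>v \<in> pverts G. (u, v) \<in> parcs G \<longrightarrow> card (nbhd G u \<inter> nbhd G v) = l)}"

definition edge_regular :: "'a pair_pre_digraph \<Rightarrow> bool" where
  "edge_regular G \<longleftrightarrow> (\<exists>n d l. G \<in> ER n d l)"

text \<open>The copy \<open>u\<^sub>i\<close> of a vertex \<open>u\<close> is the pair \<open>(u, i)\<close>. Both arcs of every edge are present,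
  as adjacency and distance are symmetric in \<open>G\<close>.\<close>

definition shadow :: "nat \<Rightarrow> nat set \<Rightarrow> 'a pair_pre_digraph \<Rightarrow> ('a \<times> nat) pair_pre_digraph" where
  "shadow m X G =
    \<lparr> pverts = pverts G \<times> {1..m},
      parcs = {((u, i), (v, i)) | u v i. i \<in> {1..m} \<and> (u, v) \<in> parcs G} \<union>
              {((u, i), (v, j)) | u v i j. u \<in> pverts G \<and> v \<in> pverts G \<and>
                 i \<in> {1..m} \<and> j \<in> {1..m} \<and> i \<noteq> j \<and> u \<in> (\<Union>x \<in> X. nbhd_at G x v)} \<rparr>"

end

theory Submission
  imports Defs
begin

text \<open>With \<open>M(v)\<close> the union of the \<open>N\<^sup>x(v)\<close> for \<open>x \<in> X\<close>, the neighborhood of \<open>v\<^sub>i\<close> in the shadow consists of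
  the copy of \<open>N(v)\<close> in layer \<open>i\<close> and the copies of \<open>M(v)\<close> in all other layers. Counting layer by layer,
  the degree of \<open>v\<^sub>i\<close> is \<open>d + (m - 1)|M(v)|\<close>; an edge inside a layer has
  \<open>\<lambda> + (m - 1)|M(u) \<inter> M(v)|\<close> common neighbors, and an edge between two layers has
  \<open>|N(v) \<inter> M(w)| + |M(v) \<inter> N(w)| + (m - 2)|M(v) \<inter> M(w)|\<close> of them. Since edges between layers
  come from walks of positive length, they exist only if \<open>G\<close> has an edge, so an edge inside a layer
  determines the common value required in condition (3).\<close>

definition nbhd_in :: "'a pair_pre_digraph \<Rightarrow> nat set \<Rightarrow> 'a \<Rightarrow> 'a set" where
  "nbhd_in G X v = (\<Union>x \<in> X. nbhd_at G x v)"

lemma nbhd_subset: "nbhd G v \<subseteq> pverts G"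
  by (auto simp: nbhd_def)

lemma nbhd_in_subset: "nbhd_in G X v \<subseteq> pverts G"
  by (auto simp: nbhd_in_def nbhd_at_def)

lemma pverts_shadow: "pverts (shadow m X G) = pverts G \<times> {1..m}"
  by (simp add: shadow_def)

lemma arc_shadow_iff:
  "((u, i), (v, j)) \<in> parcs (shadow m X G) \<longleftrightarrow> i \<in> {1..m} \<and> j \<in> {1..m} \<and>
     (if i = j then (u, v) \<in> parcs G else u \<in> pverts G \<and> v \<in> pverts G \<and> u \<in> nbhd_in G X v)"
  by (auto simp: shadow_def nbhd_in_def)

section \<open>Distance in a symmetric digraph\<close>

context pair_graph
begin

text \<open>Unit costs make the cost of a walk its length. With no walk the infimum is over the
  empty set and equals \<infinity>.\<close>

lemma gdist_eq_INF: "gdist G u v = (INF p \<in> {p. awalk u p v}. ereal (real (length p)))"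
proof -
  have "awalk_cost (\<lambda>_. 1) p = real (length p)" for p :: "('a \<times> 'a) list"
    by (induction p) auto
  then show ?thesis
    by (simp add: gdist_def \<mu>_def)
qed

text \<open>In a symmetric digraph the reversal of a walk is a walk of the same length, which gives
  one inequality for all pairs and hence both.\<close>

lemma gdist_commute: "gdist G u v = gdist G v u"
proof -
  have "gdist G v u \<le> gdist G u v" for u v
    unfolding gdist_eq_INF
  proof (rule INF_greatest)
    fix p assume "p \<in> {p. awalk u p v}"
    then have "awalk v (rev_path p) u" by simp
    moreover have "length (rev_path p) = length p"
      by (induction p) auto
    ultimately show "(INF p \<in> {p. awalk v p u}. ereal (real (length p))) \<le> ereal (real (length p))"
      by (intro INF_lower2[of "rev_path p"]) auto
  qed
  then show ?thesis by (intro antisym)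
qed

text \<open>Without arcs the only walks are empty, so every distance is 0 or \<infinity> and never a
  positive integer.\<close>

lemma nbhd_at_nonempty_imp_arc:
  assumes "w \<in> nbhd_at G k v" "k \<ge> 1"
  shows "parcs G \<noteq> {}"
proof
  assume no_arc: "parcs G = {}"
  have dist: "gdist G v w = ereal (real k)"
    using assms by (simp add: nbhd_at_def)
  have Nil: "p = []" if "awalk v p w" for p
    using that no_arc by (cases p) (auto simp: awalk_Cons_iff)
  show False
  proof (cases "\<exists>p. awalk v p w")
    case True
    then have "awalk v [] w" using Nil by blast
    then have "gdist G v w \<le> ereal (real (length ([] :: ('a \<times> 'a) list)))"
      unfolding gdist_eq_INF by (intro INF_lower) auto
    with dist assms(2) show False by simp
  next
    case False
    then have "gdist G v w = \<infinity>" by (simp add: gdist_eq_INF top_ereal_def)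
    with dist show False by simp
  qed
qed

section \<open>Symmetry, finiteness and counting of neighborhoods\<close>

lemma arc_commute: "(u, v) \<in> parcs G \<longleftrightarrow> (v, u) \<in> parcs G"
  using arcs_symmetric by auto

lemma nbhd_in_commute:
  assumes "u \<in> pverts G" "v \<in> pverts G"
  shows "u \<in> nbhd_in G X v \<longleftrightarrow> v \<in> nbhd_in G X u"
  using assms gdist_commute by (simp add: nbhd_in_def nbhd_at_def)

lemma out_degree_eq_card_nbhd: "out_degree (with_proj G) v = card (nbhd G v)"
proof -
  have "out_arcs (with_proj G) v = Pair v ` nbhd G v"
    by (auto simp: out_arcs_def nbhd_def dest: in_arcsD2)
  then show ?thesis
    by (simp add: out_degree_def card_image inj_on_def)
qed

lemma finite_nbhd [simp]: "finite (nbhd G v)"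
  using nbhd_subset pair_finite_verts by (rule finite_subset)

lemma finite_nbhd_in [simp]: "finite (nbhd_in G X v)"
  using nbhd_in_subset pair_finite_verts by (rule finite_subset)

text \<open>Spheres around \<open>v\<close> of different radii are disjoint, and injectivity of
  \<open>x\<close> keeps the radii different. The set \<open>A\<close> is left free so that one
  statement serves single sums (\<open>A = UNIV\<close>), mixed sums and, applied twice, double
  sums.\<close>

lemma sum_card_Int_nbhd_at:
  assumes "inj_on x I" "finite I"
  shows "(\<Sum>i\<in>I. card (A \<inter> nbhd_at G (x i) v)) = card (A \<inter> nbhd_in G (x ` I) v)"
proof -
  have "A \<inter> nbhd_in G (x ` I) v = (\<Union>i\<in>I. A \<inter> nbhd_at G (x i) v)"
    by (auto simp: nbhd_in_def)
  moreover have "card (\<Union>i\<in>I. A \<inter> nbhd_at G (x i) v) = (\<Sum>i\<in>I. card (A \<inter> nbhd_at G (x i) v))"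
  proof (rule card_UN_disjoint)
    show "\<forall>i\<in>I. finite (A \<inter> nbhd_at G (x i) v)"
      using pair_finite_verts by (auto simp: nbhd_at_def)
    show "\<forall>i\<in>I. \<forall>j\<in>I. i \<noteq> j \<longrightarrow> (A \<inter> nbhd_at G (x i) v) \<inter> (A \<inter> nbhd_at G (x j) v) = {}"
      using assms(1) by (auto simp: nbhd_at_def inj_on_def)
  qed (fact assms(2))
  ultimately show ?thesis by simp
qed

text \<open>Arcs between layers are symmetric because distance is. No loop arises, since such arcs
  change the layer and arcs inside a layer come from \<open>G\<close>.\<close>

lemma pair_graph_shadow: "pair_graph (shadow m X G)"
proof
  let ?H = "shadow m X G"
  show "fst e \<in> pverts ?H" "snd e \<in> pverts ?H" if "e \<in> parcs ?H" for e
    using that by (auto simp: shadow_def dest: in_arcsD1 in_arcsD2)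
  show "finite (pverts ?H)"
    using pair_finite_verts by (simp add: pverts_shadow)
  have "parcs ?H \<subseteq> pverts ?H \<times> pverts ?H"
    by (auto simp: shadow_def dest: in_arcsD1 in_arcsD2)
  then show "finite (parcs ?H)"
    using \<open>finite (pverts ?H)\<close> by (metis finite_SigmaI finite_subset)
  show "symmetric (with_proj ?H)"
    unfolding symmetric_def
    by (auto intro!: symI simp: arc_shadow_iff nbhd_in_commute arc_commute split: if_splits)
  show "fst e \<noteq> snd e" if "e \<in> parcs ?H" for e
    using that pair_no_loops by (auto simp: shadow_def)
qed

section \<open>Neighborhoods in the shadow and their sizes\<close>

lemma nbhd_shadow:
  assumes "v \<in> pverts G" "i \<in> {1..m}"
  shows "nbhd (shadow m X G) (v, i) = nbhd G v \<times> {i} \<union> nbhd_in G X v \<times> ({1..m} - {i})"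
  \<comment> \<open>The shadow asks the source to lie in the set of the target; symmetry of distance
    turns this into a condition on the set of \<open>v\<close>.\<close>
  using assms nbhd_in_subset[of G X v]
  by (auto simp: nbhd_def pverts_shadow arc_shadow_iff nbhd_in_commute split: if_splits)

lemma card_nbhd_shadow:
  assumes "v \<in> pverts G" "i \<in> {1..m}"
  shows "card (nbhd (shadow m X G) (v, i)) = card (nbhd G v) + (m - 1) * card (nbhd_in G X v)"
  unfolding nbhd_shadow[OF assms] using assms(2)
  by (subst card_Un_disjoint) (auto simp: card_cartesian_product)

lemma card_common_nbhd_shadow_same:
  assumes "u \<in> pverts G" "v \<in> pverts G" "i \<in> {1..m}"
  shows "card (nbhd (shadow m X G) (u, i) \<inter> nbhd (shadow m X G) (v, i)) =
    card (nbhd G u \<inter> nbhd G v) + (m - 1) * card (nbhd_in G X u \<inter> nbhd_in G X v)"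
proof -
  have "nbhd (shadow m X G) (u, i) \<inter> nbhd (shadow m X G) (v, i) =
      (nbhd G u \<inter> nbhd G v) \<times> {i} \<union> (nbhd_in G X u \<inter> nbhd_in G X v) \<times> ({1..m} - {i})"
    using assms by (auto simp: nbhd_shadow)
  also have "card \<dots> =
      card (nbhd G u \<inter> nbhd G v) + (m - 1) * card (nbhd_in G X u \<inter> nbhd_in G X v)"
    using assms(3) by (subst card_Un_disjoint) (auto simp: card_cartesian_product)
  finally show ?thesis .
qed

text \<open>Layer \<open>i\<close> meets the own layer of \<open>v\<close> but a foreign layer of
  \<open>w\<close>, and layer \<open>j\<close> the reverse; the other \<open>m - 2\<close> layers
  are foreign to both.\<close>

lemma card_common_nbhd_shadow_diff:
  assumes "v \<in> pverts G" "w \<in> pverts G" "i \<in> {1..m}" "j \<in> {1..m}" "i \<noteq> j"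
  shows "card (nbhd (shadow m X G) (v, i) \<inter> nbhd (shadow m X G) (w, j)) =
    card (nbhd G v \<inter> nbhd_in G X w) + card (nbhd_in G X v \<inter> nbhd G w)
    + (m - 2) * card (nbhd_in G X v \<inter> nbhd_in G X w)"
proof -
  have "nbhd (shadow m X G) (v, i) \<inter> nbhd (shadow m X G) (w, j) =
      ((nbhd G v \<inter> nbhd_in G X w) \<times> {i} \<union> (nbhd_in G X v \<inter> nbhd G w) \<times> {j}) \<union>
      (nbhd_in G X v \<inter> nbhd_in G X w) \<times> ({1..m} - {i, j})"
    using assms by (auto simp: nbhd_shadow)
  also have "card \<dots> = card ((nbhd G v \<inter> nbhd_in G X w) \<times> {i} \<union> (nbhd_in G X v \<inter> nbhd G w) \<times> {j})
      + card ((nbhd_in G X v \<inter> nbhd_in G X w) \<times> ({1..m} - {i, j}))"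
    by (rule card_Un_disjoint) auto
  also have "card ((nbhd G v \<inter> nbhd_in G X w) \<times> {i} \<union> (nbhd_in G X v \<inter> nbhd G w) \<times> {j})
      = card (nbhd G v \<inter> nbhd_in G X w) + card (nbhd_in G X v \<inter> nbhd G w)"
    using assms(5) by (subst card_Un_disjoint) (auto simp: card_cartesian_product)
  also have "card ({1..m} - {i, j}) = m - 2"
    using assms(3-5) by (subst card_Diff_subset) auto
  then have "card ((nbhd_in G X v \<inter> nbhd_in G X w) \<times> ({1..m} - {i, j})) =
      (m - 2) * card (nbhd_in G X v \<inter> nbhd_in G X w)"
    by (simp add: card_cartesian_product)
  finally show ?thesis .
qed

section \<open>Edge-regularity as a counting condition\<close>

lemma edge_regular_iff:
  "edge_regular G \<longleftrightarrow> (\<exists>d l. (\<forall>v \<in> pverts G. card (nbhd G v) = d) \<and>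
     (\<forall>u v. (u, v) \<in> parcs G \<longrightarrow> card (nbhd G u \<inter> nbhd G v) = l))"
proof -
  have "(\<forall>u \<in> pverts G. \<forall>v \<in> pverts G. (u, v) \<in> parcs G \<longrightarrow> card (nbhd G u \<inter> nbhd G v) = l) \<longleftrightarrow>
      (\<forall>u v. (u, v) \<in> parcs G \<longrightarrow> card (nbhd G u \<inter> nbhd G v) = l)" for l
    using in_arcsD1 in_arcsD2 by blast
  then show ?thesis
    using pair_graph by (simp add: edge_regular_def ER_def out_degree_eq_card_nbhd)
qed

text \<open>One constant \<open>L\<close> has to serve both kinds of edges. This version stays in
  the natural numbers and avoids solving for the contribution of a single layer.\<close>

lemma edge_regular_shadow_iff:
  assumes deg: "\<And>v. v \<in> pverts G \<Longrightarrow> card (nbhd G v) = d"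
    and common: "\<And>u v. (u, v) \<in> parcs G \<Longrightarrow> card (nbhd G u \<inter> nbhd G v) = l"
    and "m \<ge> 2"
  shows "edge_regular (shadow m X G) \<longleftrightarrow> (\<exists>D L.
    (\<forall>v \<in> pverts G. d + (m - 1) * card (nbhd_in G X v) = D) \<and>
    (\<forall>u v. (u, v) \<in> parcs G \<longrightarrow> l + (m - 1) * card (nbhd_in G X u \<inter> nbhd_in G X v) = L) \<and>
    (\<forall>v \<in> pverts G. \<forall>w \<in> nbhd_in G X v.
      card (nbhd G v \<inter> nbhd_in G X w) + card (nbhd_in G X v \<inter> nbhd G w)
      + (m - 2) * card (nbhd_in G X v \<inter> nbhd_in G X w) = L))"
    (is "_ \<longleftrightarrow> (\<exists>D L. ?deg D \<and> ?same L \<and> ?diff L)")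
proof -
  let ?H = "shadow m X G"
  \<comment> \<open>Layers 1 and 2 serve as representatives: the counts do not depend on the layers
    chosen, only on whether they coincide.\<close>
  have layers: "1 \<in> {1..m}" "2 \<in> {1..m}" using assms(3) by auto
  have "(\<forall>a \<in> pverts ?H. card (nbhd ?H a) = D) \<longleftrightarrow> ?deg D" for D
    using layers by (auto simp: pverts_shadow card_nbhd_shadow deg)
  moreover have "(\<forall>a b. (a, b) \<in> parcs ?H \<longrightarrow> card (nbhd ?H a \<inter> nbhd ?H b) = L) \<longleftrightarrow>
      ?same L \<and> ?diff L" (is "?arcs \<longleftrightarrow> _") for L
  proof (intro iffI conjI)
    assume *: ?arcs
    show "?same L"
    proof (intro allI impI)
      fix u v assume arc: "(u, v) \<in> parcs G"
      have "card (nbhd ?H (u, 1) \<inter> nbhd ?H (v, 1)) = L"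
        using * arc layers by (auto simp: arc_shadow_iff)
      then show "l + (m - 1) * card (nbhd_in G X u \<inter> nbhd_in G X v) = L"
        using card_common_nbhd_shadow_same[of u v 1 m X] arc layers
        by (simp add: common in_arcsD1[OF arc] in_arcsD2[OF arc])
    qed
    show "?diff L"
    proof (intro ballI)
      fix v w assume v: "v \<in> pverts G" and w: "w \<in> nbhd_in G X v"
      have w': "w \<in> pverts G" using w nbhd_in_subset by fast
      have "((v, 1), (w, 2)) \<in> parcs ?H"
        using v w w' layers by (simp add: arc_shadow_iff nbhd_in_commute)
      with * have "card (nbhd ?H (v, 1) \<inter> nbhd ?H (w, 2)) = L" by blast
      then show "card (nbhd G v \<inter> nbhd_in G X w) + card (nbhd_in G X v \<inter> nbhd G w)
          + (m - 2) * card (nbhd_in G X v \<inter> nbhd_in G X w) = L"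
        using v w' layers by (simp add: card_common_nbhd_shadow_diff)
    qed
  next
    assume *: "?same L \<and> ?diff L"
    have "card (nbhd ?H (u, i) \<inter> nbhd ?H (v, j)) = L" if "((u, i), (v, j)) \<in> parcs ?H" for u i v j
    proof (cases "i = j")
      case True
      with that have arc: "(u, v) \<in> parcs G" and i: "i \<in> {1..m}"
        by (auto simp: arc_shadow_iff)
      then show ?thesis
        using True * common[OF arc]
        by (simp add: card_common_nbhd_shadow_same in_arcsD1[OF arc] in_arcsD2[OF arc])
    next
      case False
      with that have "u \<in> pverts G" "v \<in> pverts G" "v \<in> nbhd_in G X u" "i \<in> {1..m}" "j \<in> {1..m}"
        by (auto simp: arc_shadow_iff nbhd_in_commute)
      then show ?thesis
        using False * by (simp add: card_common_nbhd_shadow_diff)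
    qed
    then show ?arcs by auto
  qed
  ultimately show ?thesis
    unfolding pair_graph.edge_regular_iff[OF pair_graph_shadow] by simp
qed

end

theorem theorem3p2:
  fixes G :: "'a pair_pre_digraph" and n d l m p :: nat and x :: "nat \<Rightarrow> nat" and X :: "nat set"
  assumes "G \<in> ER n d l"
    and "m \<ge> 2"
    and "p \<ge> 1" and "x 1 \<ge> 1" and "strict_mono_on {1..p} x" and "X = x ` {1..p}"
  shows "edge_regular (shadow m X G) \<longleftrightarrow>
    (\<exists>dbar lbar :: int.
       (\<forall>v \<in> pverts G. int (\<Sum>i=1..p. card (nbhd_at G (x i) v)) = dbar) \<and>
       (\<forall>u \<in> pverts G. \<forall>v \<in> pverts G. (u, v) \<in> parcs G \<longrightarrow>
          int (\<Sum>i=1..p. \<Sum>j=1..p. card (nbhd_at G (x i) u \<inter> nbhd_at G (x j) v)) = lbar) \<and>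
       (\<forall>v \<in> pverts G. \<forall>w \<in> pverts G. w \<in> (\<Union>q \<in> {1..p}. nbhd_at G (x q) v) \<longrightarrow>
          int (\<Sum>i=1..p. card (nbhd G v \<inter> nbhd_at G (x i) w))
          + int (\<Sum>j=1..p. card (nbhd_at G (x j) v \<inter> nbhd G w))
          + (int m - 2) * int (\<Sum>k=1..p. \<Sum>r=1..p. card (nbhd_at G (x k) v \<inter> nbhd_at G (x r) w))
          = int l + (int m - 1) * lbar))"
proof -
  have "pair_graph G" using assms(1) by (simp add: ER_def)
  then interpret pair_graph G .
  have deg: "card (nbhd G v) = d" if "v \<in> pverts G" for v
    using assms(1) that by (simp add: ER_def out_degree_eq_card_nbhd)
  have common: "card (nbhd G u \<inter> nbhd G v) = l" if "(u, v) \<in> parcs G" for u v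
    using assms(1) that by (auto simp: ER_def dest: in_arcsD1 in_arcsD2)
  have inj: "inj_on x {1..p}"
    using assms(5) by (rule strict_mono_on_imp_inj_on)
  \<comment> \<open>Monotonicity makes \<open>x 1\<close> the least element of
    \<open>X\<close>.\<close>
  have pos: "k \<ge> 1" if k: "k \<in> X" for k
  proof -
    obtain i where i: "i \<in> {1..p}" "k = x i" using k assms(6) by blast
    then have "x 1 \<le> x i"
      using strict_mono_on_leD[OF assms(5), of 1 i] by simp
    with i assms(4) show ?thesis by simp
  qed
  note sum1 = sum_card_Int_nbhd_at[OF inj finite_atLeastAtMost, folded assms(6)]
  have sum1': "(\<Sum>i=1..p. card (nbhd_at G (x i) v \<inter> A)) = card (nbhd_in G X v \<inter> A)" for v A
    using sum1[of A v] by (simp add: Int_commute)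
  have sum0: "(\<Sum>i=1..p. card (nbhd_at G (x i) v)) = card (nbhd_in G X v)" for v
    using sum1[of UNIV v] by simp
  have sum2: "(\<Sum>i=1..p. \<Sum>j=1..p. card (nbhd_at G (x i) u \<inter> nbhd_at G (x j) v)) =
      card (nbhd_in G X u \<inter> nbhd_in G X v)" for u v
    by (simp only: sum1 sum1')
  have union: "(\<Union>q \<in> {1..p}. nbhd_at G (x q) v) = nbhd_in G X v" for v
    by (simp add: nbhd_in_def assms(6))
  \<comment> \<open>As \<open>m\<close> is at least 2, the truncated subtractions agree with the
    integer ones.\<close>
  have m1: "int (m - 1) = int m - 1" and m2: "int (m - 2) = int m - 2"
    using assms(2) by auto
  let ?c = "\<lambda>u v. card (nbhd_in G X u \<inter> nbhd_in G X v)"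
  let ?cross = "\<lambda>v w. card (nbhd G v \<inter> nbhd_in G X w) + card (nbhd_in G X v \<inter> nbhd G w)
    + (m - 2) * ?c v w"
  have int_same: "int (l + (m - 1) * ?c u v) = int l + (int m - 1) * int (?c u v)" for u v
    by (simp only: of_nat_add of_nat_mult m1)
  have int_cross: "int (?cross v w) = int (card (nbhd G v \<inter> nbhd_in G X w))
      + int (card (nbhd_in G X v \<inter> nbhd G w)) + (int m - 2) * int (?c v w)" for v w
    by (simp only: of_nat_add of_nat_mult m2)
  have shadow_iff: "edge_regular (shadow m X G) \<longleftrightarrow> (\<exists>D L.
      (\<forall>v \<in> pverts G. d + (m - 1) * card (nbhd_in G X v) = D) \<and>
      (\<forall>u v. (u, v) \<in> parcs G \<longrightarrow> l + (m - 1) * ?c u v = L) \<and>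
      (\<forall>v \<in> pverts G. \<forall>w \<in> nbhd_in G X v. ?cross v w = L))"
    using deg common assms(2) by (rule edge_regular_shadow_iff)
  show ?thesis
    unfolding shadow_iff sum2 sum1 sum1' sum0 union int_cross[symmetric]
  proof (intro iffI; elim exE conjE)
    fix D L
    assume D: "\<forall>v \<in> pverts G. d + (m - 1) * card (nbhd_in G X v) = D"
      and same: "\<forall>u v. (u, v) \<in> parcs G \<longrightarrow> l + (m - 1) * ?c u v = L"
      and cross: "\<forall>v \<in> pverts G. \<forall>w \<in> nbhd_in G X v. ?cross v w = L"
    \<comment> \<open>At any vertex \<open>D - d\<close> is \<open>m - 1\<close> times a
      cardinality, so subtraction and division are exact. Without vertices the value is irrelevant;
      likewise for \<open>lbar\<close> below without edges.\<close>
    define dbar where "dbar = (D - d) div (m - 1)"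
    have d: "card (nbhd_in G X v) = dbar" if "v \<in> pverts G" for v
      using D[rule_format, OF that] assms(2) by (auto simp: dbar_def)
    define lbar where "lbar = (L - l) div (m - 1)"
    have lam: "?c u v = lbar" if "(u, v) \<in> parcs G" for u v
      using same[rule_format, OF that] assms(2) by (auto simp: lbar_def)
    have "int (?cross v w) = int l + (int m - 1) * int lbar"
      if v: "v \<in> pverts G" and w: "w \<in> nbhd_in G X v" for v w
    proof -
      \<comment> \<open>\<open>L\<close> is tied to \<open>lbar\<close> only through an edge of
        \<open>G\<close>; the positive distance from \<open>v\<close> to \<open>w\<close> provides
        one.\<close>
      obtain a b where ab: "(a, b) \<in> parcs G"
        using w nbhd_at_nonempty_imp_arc pos by (fastforce simp: nbhd_in_def)
      have "?cross v w = l + (m - 1) * ?c a b"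
        using cross v w same ab by simp
      then show ?thesis
        by (metis int_same lam[OF ab])
    qed
    with d lam show "\<exists>dbar lbar :: int. (\<forall>v \<in> pverts G. int (card (nbhd_in G X v)) = dbar) \<and>
        (\<forall>u \<in> pverts G. \<forall>v \<in> pverts G. (u, v) \<in> parcs G \<longrightarrow> int (?c u v) = lbar) \<and>
        (\<forall>v \<in> pverts G. \<forall>w \<in> pverts G. w \<in> nbhd_in G X v \<longrightarrow>
          int (?cross v w) = int l + (int m - 1) * lbar)"
      by (intro exI[of _ "int dbar"] exI[of _ "int lbar"]) blast
  next
    fix dbar lbar :: int
    assume d: "\<forall>v \<in> pverts G. int (card (nbhd_in G X v)) = dbar"
      and lam: "\<forall>u \<in> pverts G. \<forall>v \<in> pverts G. (u, v) \<in> parcs G \<longrightarrow> int (?c u v) = lbar"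
      and cross: "\<forall>v \<in> pverts G. \<forall>w \<in> pverts G. w \<in> nbhd_in G X v \<longrightarrow>
          int (?cross v w) = int l + (int m - 1) * lbar"
    \<comment> \<open>Wherever a condition applies, the integer in it equals a cardinality or a sum
      of natural numbers, so \<open>nat\<close> loses nothing, here and in the choice of
      \<open>L\<close>.\<close>
    have "d + (m - 1) * card (nbhd_in G X v) = d + (m - 1) * nat dbar" if "v \<in> pverts G" for v
      using d that by force
    moreover have "l + (m - 1) * ?c u v = nat (int l + (int m - 1) * lbar)"
      if "(u, v) \<in> parcs G" for u v
    proof -
      have "int (?c u v) = lbar"
        using lam that by (blast dest: in_arcsD1 in_arcsD2)
      then show ?thesis
        using int_same[of u v] by (metis nat_int)
    qed
    moreover have "?cross v w = nat (int l + (int m - 1) * lbar)"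
      if "v \<in> pverts G" "w \<in> nbhd_in G X v" for v w
      using cross that nbhd_in_subset[of G X v] by (metis nat_int subsetD)
    ultimately show "\<exists>D L. (\<forall>v \<in> pverts G. d + (m - 1) * card (nbhd_in G X v) = D) \<and>
        (\<forall>u v. (u, v) \<in> parcs G \<longrightarrow> l + (m - 1) * ?c u v = L) \<and>
        (\<forall>v \<in> pverts G. \<forall>w \<in> nbhd_in G X v. ?cross v w = L)"
      by blast
  qed
qed

end
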